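(* Let $G$ be a locally compact second countable group with left Haar measure $\lambda$ and let $(X,\mu)$ be a nonsingular $G$-space. For $f\in L^1_+(X,\mu)$ put $$\mathcal{C}_f=\{x\in X: S_f^G(x)=+\infty\},\qquad \mathcal{D}_f=X\setminus \mathcal{C}_f .$$ Then there exists an essentially unique (i.e. unique modulo $\mu$-null sets) decomposition $X=\mathcal{C}\sqcup\mathcal{D}$ into $G$-invariant Borel sets such that $$\mu(\mathcal{C}\triangle\mathcal{C}_f)=0\quad\text{and}\quad \mu(\mathcal{D}\triangle\mathcal{D}_f)=0\qquad\text{for every } f\in L^1_+(X,\mu).$$ In particular, $\mathcal{C}_f$ and $\mathcal{D}_f$ are independent of $f\in L^1_+(X,\mu)$ modulo $\mu$. Moreover, the decomposition depends only on the measure class of $\mu$: if $\mu'$ is a $\sigma$-finite Borel measure on $X$ equivalent to $\mu$, then the decompositions of $(X,\mu)$ and of $(X,\mu')$ coincide modulo $\mu$.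
   Context: A Borel $G$-space is a standard Borel space $X$ with a Borel map $G\times X\to X$, $(g,x)\mapsto g.x$, such that $e.x=x$ and $(gh).x=g.(h.x)$ for all $g,h\in G$, $x\in X$. A nonsingular $G$-space is a pair $(X,\mu)$ where $X$ is a Borel $G$-space and $\mu$ is a $\sigma$-finite Borel measure on $X$ with $\mu\circ g\sim\mu$ (mutual absolute continuity) for every $g\in G$, where $(\mu\circ g)(A)=\mu(g.A)$. Its Radon--Nikodym cocycle is a Borel map $\nabla:G\times X\to\mathbb{R}_{>0}$, $(g,x)\mapsto\nabla_g(x)$, with $\nabla_e(x)=1$ and $\nabla_{gh}(x)=\nabla_g(h.x)\nabla_h(x)$ for all $g,h\in G$, $x\in X$, and $\nabla_g=\frac{d\mu\circ g}{d\mu}$ $\mu$-a.e. for each $g\in G$ (such a pointwise cocycle always exists). $L^1_+(X,\mu)$ is the class of everywhere defined, strictly positive functions in $L^1(X,\mu)$. For $f\in L^1_+(X,\mu)$, $$S_f^G(x)=\int_G\nabla_g(x)f(g.x)\,d\lambda(g)=\int_G\frac{d\mu\circ g}{d\mu}(x)f(g.x)\,d\lambda(g),\quad x\in X.$$ A Borel set $A$ is $G$-invariant if $G.A=A$. *)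

theory Defs
  imports "HOL-Analysis.Analysis"
begin

text \<open>
  Groups are written additively because the library's class of topological groups is
  \<^class>\<open>topological_group_add\<close>. Its addition is not assumed to be commutative: \<open>g + h\<close>, \<open>0\<close> and
  \<open>- g\<close> are the product, the identity and the inverse of an arbitrary topological group.
\<close>

text \<open>
  On a second countable locally compact Hausdorff group, a nonzero left-invariant Borel measure
  that is finite on compact sets is automatically regular, hence a left Haar measure.
\<close>

definition left_haar_measure :: "'g::topological_group_add measure \<Rightarrow> bool" where
  "left_haar_measure haar \<longleftrightarrow>
     sets haar = sets borel \<and>
     emeasure haar UNIV \<noteq> 0 \<and>
     (\<forall>K. compact K \<longrightarrow> emeasure haar K < \<infinity>) \<and>
     (\<forall>g. \<forall>A\<in>sets borel. emeasure haar ((\<lambda>h. g + h) ` A) = emeasure haar A)"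

text \<open>
  In the following, \<open>M\<close> carries both the Borel structure \<open>(space M, sets M)\<close> of \<open>X\<close> and the
  measure \<open>\<mu>\<close>; all pointwise conditions are relativised to \<^term>\<open>space M\<close>.
\<close>

definition standard_borel_space :: "'x measure \<Rightarrow> bool" where
  "standard_borel_space M \<longleftrightarrow>
     (\<exists>T. completely_metrizable_space T \<and> second_countable T \<and> topspace T = space M \<and>
          sets M = sigma_sets (space M) {U. openin T U})"

definition borel_G_space :: "'x measure \<Rightarrow> ('g::topological_group_add \<Rightarrow> 'x \<Rightarrow> 'x) \<Rightarrow> bool" where
  "borel_G_space M act \<longleftrightarrow>
     standard_borel_space M \<and>
     (\<lambda>(g, x). act g x) \<in> measurable (borel \<Otimes>\<^sub>M M) M \<and>
     (\<forall>x\<in>space M. act 0 x = x) \<and>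
     (\<forall>g h. \<forall>x\<in>space M. act (g + h) x = act g (act h x))"

definition translated_measure :: "'x measure \<Rightarrow> ('g \<Rightarrow> 'x \<Rightarrow> 'x) \<Rightarrow> 'g \<Rightarrow> 'x measure" where
  "translated_measure M act g = measure_of (space M) (sets M) (\<lambda>A. emeasure M (act g ` A))"

text \<open>
  \<^const>\<open>measure_of\<close> yields the zero measure if its argument is not a measure; for a Borel
  \<open>G\<close>-space this does not happen.
\<close>

lemma emeasure_translated_measure:
  fixes act :: "'g::topological_group_add \<Rightarrow> 'x \<Rightarrow> 'x"
  assumes G: "borel_G_space M act" and A: "A \<in> sets M"
  shows "emeasure (translated_measure M act g) A = emeasure M (act g ` A)"
proof -
  have m: "act h \<in> measurable M M" for h
  proof -
    have "(\<lambda>x. (h, x)) \<in> measurable M (borel \<Otimes>\<^sub>M M)" by simp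
    then show ?thesis
      using G measurable_comp[of "\<lambda>x. (h, x)" M "borel \<Otimes>\<^sub>M M" "\<lambda>(g, x). act g x" M]
      by (simp add: borel_G_space_def comp_def)
  qed
  have inv: "act (- h) (act h x) = x" "act h (act (- h) x) = x" if "x \<in> space M" for h x
    using G that unfolding borel_G_space_def
    by (metis left_minus, metis right_minus)
  have im: "act g ` B = act (- g) -` B \<inter> space M" if "B \<in> sets M" for B
  proof
    show "act g ` B \<subseteq> act (- g) -` B \<inter> space M"
      using sets.sets_into_space[OF that] inv m[THEN measurable_space] by fastforce
    show "act (- g) -` B \<inter> space M \<subseteq> act g ` B"
    proof
      fix x assume "x \<in> act (- g) -` B \<inter> space M"
      then show "x \<in> act g ` B" using inv(2)[of x g] by (metis IntD1 IntD2 imageI vimageD)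
    qed
  qed
  have "translated_measure M act g = distr M M (act (- g))"
    unfolding translated_measure_def distr_def
    by (rule measure_of_eq) (auto simp: im sets.space_closed sets.sigma_sets_eq)
  then show ?thesis
    using A m by (simp add: emeasure_distr im)
qed

definition equivalent_measures :: "'x measure \<Rightarrow> 'x measure \<Rightarrow> bool" where
  "equivalent_measures M N \<longleftrightarrow>
     sets M = sets N \<and> absolutely_continuous M N \<and> absolutely_continuous N M"

definition nonsingular_G_space ::
    "'x measure \<Rightarrow> ('g::topological_group_add \<Rightarrow> 'x \<Rightarrow> 'x) \<Rightarrow> bool" where
  "nonsingular_G_space M act \<longleftrightarrow>
     borel_G_space M act \<and> sigma_finite_measure M \<and>
     (\<forall>g. equivalent_measures (translated_measure M act g) M)"

definition radon_nikodym_cocycle ::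
    "'x measure \<Rightarrow> ('g::topological_group_add \<Rightarrow> 'x \<Rightarrow> 'x) \<Rightarrow> ('g \<Rightarrow> 'x \<Rightarrow> real) \<Rightarrow> bool" where
  "radon_nikodym_cocycle M act nabla \<longleftrightarrow>
     (\<lambda>(g, x). nabla g x) \<in> borel_measurable (borel \<Otimes>\<^sub>M M) \<and>
     (\<forall>g. \<forall>x\<in>space M. 0 < nabla g x) \<and>
     (\<forall>x\<in>space M. nabla 0 x = 1) \<and>
     (\<forall>g h. \<forall>x\<in>space M. nabla (g + h) x = nabla g (act h x) * nabla h x) \<and>
     (\<forall>g. AE x in M. ennreal (nabla g x) = RN_deriv M (translated_measure M act g) x)"

definition L1_plus :: "'x measure \<Rightarrow> ('x \<Rightarrow> real) set" where
  "L1_plus M = {f. integrable M f \<and> (\<forall>x\<in>space M. 0 < f x)}"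

definition S_sum ::
    "'g measure \<Rightarrow> ('g \<Rightarrow> 'x \<Rightarrow> 'x) \<Rightarrow> ('g \<Rightarrow> 'x \<Rightarrow> real) \<Rightarrow> ('x \<Rightarrow> real) \<Rightarrow> 'x \<Rightarrow> ennreal" where
  "S_sum haar act nabla f x = (\<integral>\<^sup>+ g. ennreal (nabla g x * f (act g x)) \<partial>haar)"

definition C_set ::
    "'g measure \<Rightarrow> 'x measure \<Rightarrow> ('g \<Rightarrow> 'x \<Rightarrow> 'x) \<Rightarrow> ('g \<Rightarrow> 'x \<Rightarrow> real) \<Rightarrow> ('x \<Rightarrow> real) \<Rightarrow> 'x set" where
  "C_set haar M act nabla f = {x \<in> space M. S_sum haar act nabla f x = \<infinity>}"

definition D_set ::
    "'g measure \<Rightarrow> 'x measure \<Rightarrow> ('g \<Rightarrow> 'x \<Rightarrow> 'x) \<Rightarrow> ('g \<Rightarrow> 'x \<Rightarrow> real) \<Rightarrow> ('x \<Rightarrow> real) \<Rightarrow> 'x set" where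
  "D_set haar M act nabla f = space M - C_set haar M act nabla f"

definition G_invariant :: "('g \<Rightarrow> 'x \<Rightarrow> 'x) \<Rightarrow> 'x set \<Rightarrow> bool" where
  "G_invariant act A \<longleftrightarrow> (\<Union>g. act g ` A) = A"

text \<open>
  Null symmetric differences are stated as membership in \<^const>\<open>null_sets\<close>, which includes
  measurability, since \<^const>\<open>emeasure\<close> is \<open>0\<close> on every non-measurable set.
\<close>

definition hopf_decomposition ::
    "'g measure \<Rightarrow> 'x measure \<Rightarrow> ('g \<Rightarrow> 'x \<Rightarrow> 'x) \<Rightarrow> ('g \<Rightarrow> 'x \<Rightarrow> real) \<Rightarrow> 'x set \<Rightarrow> 'x set \<Rightarrow> bool" where
  "hopf_decomposition haar M act nabla C D \<longleftrightarrow>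
     C \<in> sets M \<and> D \<in> sets M \<and> C \<union> D = space M \<and> C \<inter> D = {} \<and>
     G_invariant act C \<and> G_invariant act D \<and>
     (\<forall>f\<in>L1_plus M. sym_diff C (C_set haar M act nabla f) \<in> null_sets M \<and>
                    sym_diff D (D_set haar M act nabla f) \<in> null_sets M)"

end

theory Submission
  imports Defs
begin

text \<open>
  Write \<open>S f x\<close> for the integral of \<open>nabla g x * f (act g x)\<close> over the group. The function
  \<open>a g = nabla g x * f (act g x)\<close> records \<open>f\<close> along the orbit of \<open>x\<close>, and the cocycle identity says
  that moving the base point to \<open>act g x\<close> translates \<open>a\<close> on the right by \<open>g\<close> and divides it by
  \<open>nabla g x\<close>. Right translation multiplies every Haar integral by one positive finite constant
  (\<open>nn_integral_right_translate\<close>), so finiteness of \<open>S f\<close> is constant along each orbit and the sets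
  \<open>C_f\<close> and \<open>D_f\<close> are exactly invariant.

  For the independence of \<open>f\<close>, weight points by \<open>\<phi> = f' / S f\<close>, which is \<open>0\<close> where \<open>S f\<close> is infinite.
  Then the integral of \<open>S f * \<phi>\<close> is at most that of \<open>f'\<close>, hence finite. Tonelli and the change of
  variables defining \<open>nabla\<close> turn it into the integral of \<open>f y\<close> times the integral of
  \<open>\<phi> (act (- g) y)\<close> over the group, and since \<open>f\<close> is positive the inner integral is finite for almost
  every \<open>y\<close>. The identity \<open>nn_integral_inversion_duality\<close> evaluates this inner integral times \<open>S f y\<close>
  as \<open>S f' y\<close> whenever \<open>S f y\<close> is finite, so \<open>S f'\<close> is finite almost everywhere on \<open>D_f\<close>
  (\<open>AE_S_finite\<close>). Exchanging \<open>f\<close> and \<open>f'\<close> gives equality of the two decompositions modulo null sets,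
  and uniqueness follows because every decomposition agrees with \<open>C_f\<close> for one common \<open>f\<close>.

  If \<open>N\<close> has density \<open>d\<close> with respect to \<open>\<mu>\<close>, its cocycle is \<open>nabla g x * d (act g x) / d x\<close> almost
  everywhere. So replacing \<open>(\<mu>, d * f')\<close> by \<open>(N, f')\<close> only divides \<open>S\<close> by the finite positive function
  \<open>d\<close>, and both measures have the same decomposition.
\<close>

section \<open>Haar integrals under inversion and right translation\<close>

locale haar_group =
  fixes haar :: "'g::{topological_group_add, t2_space, second_countable_topology} measure"
  assumes loc_compact: "locally_compact_space (euclidean :: 'g topology)"
    and left_haar: "left_haar_measure haar"
begin

lemma sets_haar [measurable_cong, simp]: "sets haar = sets borel"
  using left_haar by (simp add: left_haar_measure_def)

lemma space_haar [simp]: "space haar = UNIV"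
  using sets_eq_imp_space_eq[OF sets_haar] by simp

lemma emeasure_haar_translate:
  "A \<in> sets borel \<Longrightarrow> emeasure haar ((+) g ` A) = emeasure haar A"
  using left_haar by (simp add: left_haar_measure_def)

lemma uminus_measurable [measurable]: "(uminus :: 'g \<Rightarrow> 'g) \<in> borel_measurable borel"
  by (intro borel_measurable_continuous_onI) (auto simp: continuous_on_def intro!: tendsto_intros)

lemma open_left_translate:
  fixes U :: "'g set"
  assumes "open U"
  shows "open ((+) g ` U)"
proof -
  have "(+) g ` U = (\<lambda>h. - g + h) -` U"
  proof (intro equalityI subsetI)
    fix x assume "x \<in> (\<lambda>h. - g + h) -` U"
    then have "x = g + (- g + x)" "- g + x \<in> U" by (auto simp: add.assoc[symmetric])
    then show "x \<in> (+) g ` U" by blast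
  qed (auto simp: add.assoc[symmetric])
  moreover have "continuous_on UNIV (\<lambda>h::'g. - g + h)"
    by (auto simp: continuous_on_def intro!: tendsto_intros)
  ultimately show ?thesis
    using open_vimage[OF assms] by simp
qed

lemma open_right_translate_vimage:
  fixes U :: "'g set"
  assumes "open U"
  shows "open ((\<lambda>h. h + g) -` U)"
  by (intro open_vimage[OF assms]) (auto simp: continuous_on_def intro!: tendsto_intros)

text \<open>
  By the Lindelof property the group is covered by countably many translates of any nonempty open
  set. This gives both the positivity of the measure on open sets and its sigma-finiteness.
\<close>

lemma countable_translates_cover:
  fixes U :: "'g set"
  assumes "open U" "U \<noteq> {}"
  obtains I where "countable I" "(\<Union>g\<in>I. (+) g ` U) = UNIV"
proof -
  obtain u where u: "u \<in> U" using assms by blast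
  have "y \<in> (+) (y - u) ` U" for y
    using u by (intro image_eqI[of _ _ u]) auto
  then have cover: "\<Union> (range (\<lambda>g. (+) g ` U)) = UNIV" by blast
  obtain F where F: "F \<subseteq> range (\<lambda>g. (+) g ` U)" "countable F" "\<Union> F = \<Union> (range (\<lambda>g. (+) g ` U))"
    using Lindelof[of "range (\<lambda>g. (+) g ` U)"] open_left_translate[OF assms(1)] by blast
  obtain I where "countable I" "F = (\<lambda>g. (+) g ` U) ` I"
    using F(1,2) by (meson countable_subset_image)
  with F(3) cover show thesis by (intro that[of I]) auto
qed

lemma emeasure_haar_open_pos:
  assumes "open U" "U \<noteq> {}"
  shows "emeasure haar U \<noteq> 0"
proof
  assume 0: "emeasure haar U = 0"
  obtain I where I: "countable I" "(\<Union>g\<in>I. (+) g ` U) = UNIV"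
    using countable_translates_cover[OF assms] by blast
  have "(+) g ` U \<in> null_sets haar" for g
    using 0 assms(1) by (intro null_setsI) (auto simp: emeasure_haar_translate open_left_translate)
  then have "(\<Union>g\<in>I. (+) g ` U) \<in> null_sets haar"
    using I(1) by (intro null_sets_UN') auto
  then show False
    using I(2) left_haar by (auto simp: left_haar_measure_def)
qed

lemma obtain_relatively_compact_open:
  obtains U K :: "'g set" where "open U" "U \<noteq> {}" "compact K" "U \<subseteq> K"
proof -
  obtain U K :: "'g set" where "open U" "compact K" "0 \<in> U" "U \<subseteq> K"
    using loc_compact unfolding locally_compact_space_def
    by (metis UNIV_I compactin_euclidean_iff open_openin topspace_euclidean)
  then show thesis using that by blast
qed

lemma emeasure_haar_relatively_compact:
  assumes "compact K" "U \<subseteq> K" "U \<in> sets borel"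
  shows "emeasure haar U < \<infinity>"
proof -
  have "emeasure haar U \<le> emeasure haar K"
    using assms by (intro emeasure_mono) (auto intro: borel_compact)
  also have "\<dots> < \<infinity>"
    using left_haar assms by (simp add: left_haar_measure_def)
  finally show ?thesis .
qed

sublocale sigma_finite_measure haar
proof
  obtain U K :: "'g set" where U: "open U" "U \<noteq> {}" "compact K" "U \<subseteq> K"
    using obtain_relatively_compact_open by blast
  obtain I where I: "countable I" "(\<Union>g\<in>I. (+) g ` U) = UNIV"
    using countable_translates_cover[OF U(1,2)] by blast
  have "emeasure haar U \<noteq> \<infinity>"
    using emeasure_haar_relatively_compact[OF U(3,4)] U(1) by simp
  then show "\<exists>A. countable A \<and> A \<subseteq> sets haar \<and> \<Union> A = space haar \<and> (\<forall>a\<in>A. emeasure haar a \<noteq> \<infinity>)"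
  proof (intro exI conjI ballI)
    show "countable ((\<lambda>g. (+) g ` U) ` I)" using I(1) by (rule countable_image)
    show "(\<lambda>g. (+) g ` U) ` I \<subseteq> sets haar"
      using open_left_translate[OF U(1)] by (simp add: image_subset_iff)
    show "\<Union> ((\<lambda>g. (+) g ` U) ` I) = space haar" using I(2) by simp
    fix a assume "a \<in> (\<lambda>g. (+) g ` U) ` I"
    then obtain g where "a = (+) g ` U" by (rule imageE)
    then have "emeasure haar a = emeasure haar U"
      using emeasure_haar_translate[OF borel_open[OF U(1)], of g] by (rule ssubst)
    then show "emeasure haar a \<noteq> \<infinity>"
      using \<open>emeasure haar U \<noteq> \<infinity>\<close> by (rule ssubst)
  qed
qed

lemma haar_pair: "pair_sigma_finite haar haar" ..

lemma distr_left_translate: "distr haar haar ((+) g) = haar"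
proof (rule measure_eqI)
  fix A assume "A \<in> sets (distr haar haar ((+) g))"
  then have A: "A \<in> sets borel" by simp
  have "(+) g -` A = (+) (- g) ` A"
  proof (intro equalityI subsetI)
    fix x assume "x \<in> (+) g -` A"
    then show "x \<in> (+) (- g) ` A" by (intro image_eqI[of _ _ "g + x"]) (auto simp: add.assoc[symmetric])
  qed (auto simp: add.assoc[symmetric])
  then show "emeasure (distr haar haar ((+) g)) A = emeasure haar A"
    using A by (subst emeasure_distr) (auto simp: emeasure_haar_translate)
qed simp

lemma nn_integral_left_translate:
  assumes [measurable]: "F \<in> borel_measurable borel"
  shows "(\<integral>\<^sup>+h. F (g + h) \<partial>haar) = (\<integral>\<^sup>+h. F h \<partial>haar)"
proof -
  have "(\<integral>\<^sup>+h. F h \<partial>haar) = (\<integral>\<^sup>+h. F h \<partial>distr haar haar ((+) g))"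
    by (simp add: distr_left_translate)
  also have "\<dots> = (\<integral>\<^sup>+h. F (g + h) \<partial>haar)"
    by (intro nn_integral_distr) measurable
  finally show ?thesis ..
qed

text \<open>
  Two Tonelli exchanges and two left translations prove this. Classically \<open>a (h + g)\<close> integrates over
  \<open>h\<close> to the integral of \<open>a\<close> divided by the modular function at \<open>g\<close>, so the identity says that the
  inverse of the modular function is the density of the inverted Haar measure. In the present form it
  holds before the modular function is known to exist, and it yields that function afterwards.
\<close>

lemma nn_integral_inversion_duality:
  assumes [measurable]: "\<psi> \<in> borel_measurable borel" "a \<in> borel_measurable borel"
  shows "(\<integral>\<^sup>+h. \<psi> (- h) \<partial>haar) * (\<integral>\<^sup>+g. a g \<partial>haar) =
         (\<integral>\<^sup>+g. \<psi> g * (\<integral>\<^sup>+h. a (h + g) \<partial>haar) \<partial>haar)"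
proof -
  interpret P: pair_sigma_finite haar haar by (rule haar_pair)
  have "(\<integral>\<^sup>+h. \<psi> (- h) \<partial>haar) * (\<integral>\<^sup>+g. a g \<partial>haar) = (\<integral>\<^sup>+g. (\<integral>\<^sup>+h. \<psi> (- h) * a g \<partial>haar) \<partial>haar)"
    by (simp add: nn_integral_cmult nn_integral_multc)
  also have "\<dots> = (\<integral>\<^sup>+g. (\<integral>\<^sup>+h. \<psi> (- (- g + h)) * a g \<partial>haar) \<partial>haar)"
    by (intro nn_integral_cong nn_integral_left_translate[symmetric]) measurable
  also have "\<dots> = (\<integral>\<^sup>+g. (\<integral>\<^sup>+h. \<psi> (- h + g) * a g \<partial>haar) \<partial>haar)"
    by (simp add: minus_add)
  also have "\<dots> = (\<integral>\<^sup>+h. (\<integral>\<^sup>+g. \<psi> (- h + g) * a g \<partial>haar) \<partial>haar)"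
    by (intro P.Fubini') measurable
  also have "\<dots> = (\<integral>\<^sup>+h. (\<integral>\<^sup>+g. \<psi> (- h + (h + g)) * a (h + g) \<partial>haar) \<partial>haar)"
    by (intro nn_integral_cong nn_integral_left_translate[symmetric]) measurable
  also have "\<dots> = (\<integral>\<^sup>+h. (\<integral>\<^sup>+g. \<psi> g * a (h + g) \<partial>haar) \<partial>haar)"
    by (simp add: add.assoc[symmetric])
  also have "\<dots> = (\<integral>\<^sup>+g. (\<integral>\<^sup>+h. \<psi> g * a (h + g) \<partial>haar) \<partial>haar)"
    by (intro P.Fubini') measurable
  also have "\<dots> = (\<integral>\<^sup>+g. \<psi> g * (\<integral>\<^sup>+h. a (h + g) \<partial>haar) \<partial>haar)"
    by (simp add: nn_integral_cmult)
  finally show ?thesis .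
qed

text \<open>
  Let \<open>U\<close> be open and relatively compact, and let \<open>A g\<close> be the measure of the right translate \<open>U - g\<close>,
  which is positive and finite. Duality for the indicator of \<open>U\<close> and the quotient \<open>F / A\<close> expresses the
  integral of \<open>F\<close> as \<open>A 0\<close> times a functional \<open>J F\<close>. Translating both functions on the right by \<open>k\<close>
  changes the factor to \<open>A k\<close> but leaves \<open>J F\<close> fixed, since the inversion in \<open>J\<close> makes the right
  translation a left one. The ratio \<open>A k / A 0\<close> is therefore the constant.
\<close>

lemma nn_integral_right_translate:
  obtains c where "0 < c" "c < \<infinity>"
    "\<And>F. F \<in> borel_measurable borel \<Longrightarrow> (\<integral>\<^sup>+g. F (g + k) \<partial>haar) = c * (\<integral>\<^sup>+g. F g \<partial>haar)"
proof -
  obtain U K :: "'g set" where U: "open U" "U \<noteq> {}" "compact K" "U \<subseteq> K"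
    using obtain_relatively_compact_open by blast
  have [measurable]: "U \<in> sets borel" using U(1) by simp
  define A where "A g = (\<integral>\<^sup>+h. indicator U (h + g) \<partial>haar)" for g
  have [measurable]: "A \<in> borel_measurable borel"
    unfolding A_def by measurable
  have A_eq: "A g = emeasure haar ((\<lambda>h. h + g) -` U)" for g
  proof -
    have "A g = (\<integral>\<^sup>+h. indicator ((\<lambda>h. h + g) -` U) h \<partial>haar)"
      unfolding A_def by (intro nn_integral_cong) (simp add: indicator_def)
    then show ?thesis
      using open_right_translate_vimage[OF U(1)] by simp
  qed
  have A_pos: "A g \<noteq> 0" for g
  proof -
    obtain u where "u \<in> U" using U(2) by blast
    then have "u - g \<in> (\<lambda>h. h + g) -` U" by simp
    then show ?thesis
      unfolding A_eq by (intro emeasure_haar_open_pos open_right_translate_vimage U(1)) blast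
  qed
  have A_fin: "A g \<noteq> \<infinity>" for g
  proof -
    have "compact ((\<lambda>h. h - g) ` K)"
      by (intro compact_continuous_image U(3))
         (auto simp: continuous_on_def diff_conv_add_uminus simp del: add_uminus_conv_diff
               intro!: tendsto_intros)
    moreover have "(\<lambda>h. h + g) -` U \<subseteq> (\<lambda>h. h - g) ` K"
    proof
      fix h assume "h \<in> (\<lambda>h. h + g) -` U"
      then show "h \<in> (\<lambda>h. h - g) ` K"
        using U(4) by (intro image_eqI[of _ _ "h + g"]) auto
    qed
    moreover have "(\<lambda>h. h + g) -` U \<in> sets borel"
      using open_right_translate_vimage[OF U(1)] by (rule borel_open)
    ultimately show ?thesis
      unfolding A_eq by (rule emeasure_haar_relatively_compact[THEN less_imp_neq])
  qed
  define J where "J F = (\<integral>\<^sup>+h. F (- h) / A (- h) \<partial>haar)" for F :: "'g \<Rightarrow> ennreal"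
  have trans: "(\<integral>\<^sup>+g. F (g + l) \<partial>haar) = A l * J F" if [measurable]: "F \<in> borel_measurable borel" for F l
  proof -
    define \<psi> where "\<psi> g = F g / A g" for g
    have [measurable]: "\<psi> \<in> borel_measurable borel" unfolding \<psi>_def by measurable
    have "(\<integral>\<^sup>+g. F (g + l) \<partial>haar) = (\<integral>\<^sup>+g. \<psi> (g + l) * A (g + l) \<partial>haar)"
      unfolding \<psi>_def using A_pos A_fin
      by (simp add: ennreal_divide_times less_top)
    also have "\<dots> = (\<integral>\<^sup>+g. \<psi> (g + l) * (\<integral>\<^sup>+h. indicator U (h + g + l) \<partial>haar) \<partial>haar)"
      by (simp add: A_def add.assoc)
    also have "\<dots> = (\<integral>\<^sup>+h. \<psi> (- h + l) \<partial>haar) * (\<integral>\<^sup>+g. indicator U (g + l) \<partial>haar)"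
      using nn_integral_inversion_duality[of "\<lambda>g. \<psi> (g + l)" "\<lambda>g. indicator U (g + l)"] by simp
    also have "(\<integral>\<^sup>+h. \<psi> (- h + l) \<partial>haar) = (\<integral>\<^sup>+h. \<psi> (- (- l + h)) \<partial>haar)"
      by (simp add: minus_add)
    also have "\<dots> = J F"
      unfolding J_def \<psi>_def[symmetric] by (intro nn_integral_left_translate) measurable
    finally show ?thesis by (simp add: A_def mult.commute)
  qed
  show thesis
  proof (rule that[of "A k / A 0"])
    show "0 < A k / A 0"
      using A_pos A_fin by (auto simp: ennreal_zero_less_divide less_top zero_less_iff_neq_zero)
    show "A k / A 0 < \<infinity>"
      using A_pos[of 0] A_fin[of k] by (simp add: less_top[symmetric] ennreal_divide_eq_top_iff)
    fix F :: "'g \<Rightarrow> ennreal" assume F: "F \<in> borel_measurable borel"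
    show "(\<integral>\<^sup>+g. F (g + k) \<partial>haar) = A k / A 0 * (\<integral>\<^sup>+g. F g \<partial>haar)"
      using trans[OF F, of k] trans[OF F, of 0] A_pos[of 0] A_fin[of 0]
      by (simp add: ennreal_divide_times mult.assoc[symmetric] less_top)
  qed
qed

lemma nn_integral_haar_pos:
  assumes [measurable]: "F \<in> borel_measurable borel" and "\<And>g. 0 < F g"
  shows "(\<integral>\<^sup>+g. F g \<partial>haar) \<noteq> 0"
proof
  assume "(\<integral>\<^sup>+g. F g \<partial>haar) = 0"
  then have "AE g in haar. False"
    by (subst (asm) nn_integral_0_iff_AE) (use assms(2) in \<open>auto simp: less_le\<close>)
  then show False
    using left_haar by (auto simp: left_haar_measure_def AE_iff_null)
qed

end

section \<open>Actions and change of variables\<close>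

lemma L1_plus_nonempty:
  assumes "sigma_finite_measure M"
  obtains f where "f \<in> L1_plus M"
proof -
  interpret sigma_finite_measure M by fact
  obtain h where h: "h \<in> borel_measurable M" "integral\<^sup>N M h \<noteq> \<infinity>"
      "\<And>x. x \<in> space M \<Longrightarrow> 0 < h x \<and> h x < \<infinity>"
    using Ex_finite_integrable_function by blast
  note [measurable] = h(1)
  have "(\<integral>\<^sup>+x. ennreal (enn2real (h x)) \<partial>M) = integral\<^sup>N M h"
    using h(3) by (intro nn_integral_cong) simp
  then have "integrable M (\<lambda>x. enn2real (h x))"
    using h(2) by (intro integrableI_nonneg) (auto simp: less_top)
  moreover have "0 < enn2real (h x)" if "x \<in> space M" for x
    using h(3)[OF that] by (simp add: enn2real_positive_iff)
  ultimately show thesis by (intro that[of "\<lambda>x. enn2real (h x)"]) (simp add: L1_plus_def)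
qed

locale borel_G_action =
  fixes \<mu> :: "'x measure" and act :: "'g::topological_group_add \<Rightarrow> 'x \<Rightarrow> 'x"
  assumes G_space: "borel_G_space \<mu> act"
begin

lemma act_measurable [measurable]: "case_prod act \<in> measurable (borel \<Otimes>\<^sub>M \<mu>) \<mu>"
  using G_space by (simp add: borel_G_space_def)

lemma act_space [simp]: "x \<in> space \<mu> \<Longrightarrow> act g x \<in> space \<mu>"
  using measurable_space[OF act_measurable, of "(g, x)"] by (simp add: space_pair_measure)

lemma act_0 [simp]: "x \<in> space \<mu> \<Longrightarrow> act 0 x = x"
  using G_space by (simp add: borel_G_space_def)

lemma act_add: "x \<in> space \<mu> \<Longrightarrow> act (g + h) x = act g (act h x)"
  using G_space by (simp add: borel_G_space_def)

lemma act_uminus_act: "x \<in> space \<mu> \<Longrightarrow> act (- g) (act g x) = x"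
  using act_add[of x "- g" g] by simp

lemma act_act_uminus: "x \<in> space \<mu> \<Longrightarrow> act g (act (- g) x) = x"
  using act_add[of x g "- g"] by simp

lemma act_image:
  assumes "A \<in> sets \<mu>"
  shows "act g ` A = act (- g) -` A \<inter> space \<mu>"
proof (intro equalityI subsetI)
  fix x assume "x \<in> act g ` A"
  then show "x \<in> act (- g) -` A \<inter> space \<mu>"
    using sets.sets_into_space[OF assms] by (auto simp: act_uminus_act)
next
  fix x assume "x \<in> act (- g) -` A \<inter> space \<mu>"
  then show "x \<in> act g ` A"
    by (intro image_eqI[of _ _ "act (- g) x"]) (auto simp: act_act_uminus)
qed

lemma translated_measure_eq: "translated_measure \<mu> act g = distr \<mu> \<mu> (act (- g))"
proof (rule measure_eqI)
  show "sets (translated_measure \<mu> act g) = sets (distr \<mu> \<mu> (act (- g)))"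
    by (simp add: translated_measure_def)
  fix A assume "A \<in> sets (translated_measure \<mu> act g)"
  then have "A \<in> sets \<mu>" by (simp add: translated_measure_def)
  then show "emeasure (translated_measure \<mu> act g) A = emeasure (distr \<mu> \<mu> (act (- g))) A"
    by (simp add: emeasure_translated_measure[OF G_space] emeasure_distr act_image)
qed

end

locale nonsingular_action = haar_group haar
  for haar :: "'g::{topological_group_add, t2_space, second_countable_topology} measure" +
  fixes \<mu> :: "'x measure" and act :: "'g \<Rightarrow> 'x \<Rightarrow> 'x" and nabla :: "'g \<Rightarrow> 'x \<Rightarrow> real"
  assumes nonsingular: "nonsingular_G_space \<mu> act"
    and cocycle: "radon_nikodym_cocycle \<mu> act nabla"
begin

sublocale borel_G_action \<mu> act
  using nonsingular by unfold_locales (simp add: nonsingular_G_space_def)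

sublocale X: sigma_finite_measure \<mu>
  using nonsingular by (simp add: nonsingular_G_space_def)

lemma pair_sigma_finite_haar: "pair_sigma_finite haar \<mu>" ..

lemma nabla_measurable [measurable]: "case_prod nabla \<in> borel_measurable (borel \<Otimes>\<^sub>M \<mu>)"
  using cocycle by (simp add: radon_nikodym_cocycle_def)

lemma nabla_pos: "x \<in> space \<mu> \<Longrightarrow> 0 < nabla g x"
  using cocycle by (simp add: radon_nikodym_cocycle_def)

lemma nabla_add: "x \<in> space \<mu> \<Longrightarrow> nabla (g + h) x = nabla g (act h x) * nabla h x"
  using cocycle by (simp add: radon_nikodym_cocycle_def)

lemma density_nabla: "density \<mu> (\<lambda>x. ennreal (nabla g x)) = distr \<mu> \<mu> (act (- g))"
proof -
  have "absolutely_continuous \<mu> (translated_measure \<mu> act g)"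
    using nonsingular by (simp add: nonsingular_G_space_def equivalent_measures_def)
  then have "density \<mu> (RN_deriv \<mu> (translated_measure \<mu> act g)) = translated_measure \<mu> act g"
    by (intro X.density_RN_deriv) (simp_all add: translated_measure_eq)
  moreover have "AE x in \<mu>. ennreal (nabla g x) = RN_deriv \<mu> (translated_measure \<mu> act g) x"
    using cocycle by (simp add: radon_nikodym_cocycle_def)
  then have "density \<mu> (\<lambda>x. ennreal (nabla g x)) = density \<mu> (RN_deriv \<mu> (translated_measure \<mu> act g))"
    by (intro density_cong) measurable
  ultimately show ?thesis by (simp add: translated_measure_eq)
qed

lemma nn_integral_nabla:
  assumes [measurable]: "F \<in> borel_measurable \<mu>"
  shows "(\<integral>\<^sup>+x. ennreal (nabla g x) * F x \<partial>\<mu>) = (\<integral>\<^sup>+x. F (act (- g) x) \<partial>\<mu>)"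
proof -
  have "(\<integral>\<^sup>+x. ennreal (nabla g x) * F x \<partial>\<mu>) = (\<integral>\<^sup>+x. F x \<partial>density \<mu> (\<lambda>x. ennreal (nabla g x)))"
    by (subst nn_integral_density) measurable
  also have "\<dots> = (\<integral>\<^sup>+x. F (act (- g) x) \<partial>\<mu>)"
    unfolding density_nabla by (intro nn_integral_distr) measurable
  finally show ?thesis .
qed

section \<open>Invariance of the conservative and dissipative parts\<close>

abbreviation S where "S \<equiv> S_sum haar act nabla"

context
  fixes f assumes f: "f \<in> L1_plus \<mu>"
begin

lemma f_measurable [measurable]: "f \<in> borel_measurable \<mu>"
  using f by (auto simp: L1_plus_def)

lemma f_pos: "x \<in> space \<mu> \<Longrightarrow> 0 < f x"
  using f by (auto simp: L1_plus_def)

lemma orbit_measurable [measurable]: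
  "x \<in> space \<mu> \<Longrightarrow> (\<lambda>g. ennreal (nabla g x * f (act g x))) \<in> borel_measurable borel"
  by measurable

lemma S_measurable [measurable]: "S f \<in> borel_measurable \<mu>"
proof -
  have "(\<lambda>x. \<integral>\<^sup>+ g. ennreal (nabla g x * f (act g x)) \<partial>haar) \<in> borel_measurable \<mu>"
    by measurable
  then show ?thesis by (simp add: S_sum_def[abs_def])
qed

lemma S_pos: "x \<in> space \<mu> \<Longrightarrow> S f x \<noteq> 0"
  unfolding S_sum_def by (intro nn_integral_haar_pos) (auto simp: nabla_pos f_pos)

text \<open>
  The cocycle identity makes a change of base point within an orbit a right translation of the
  integrand, up to the factor \<open>nabla g x\<close>.
\<close>

lemma S_act:
  assumes x: "x \<in> space \<mu>"
  shows "(\<integral>\<^sup>+h. ennreal (nabla (h + g) x * f (act (h + g) x)) \<partial>haar) = ennreal (nabla g x) * S f (act g x)"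
proof -
  have "(\<integral>\<^sup>+h. ennreal (nabla (h + g) x * f (act (h + g) x)) \<partial>haar) =
      (\<integral>\<^sup>+h. ennreal (nabla g x) * ennreal (nabla h (act g x) * f (act h (act g x))) \<partial>haar)"
    using nabla_pos[OF x, of g]
    by (intro nn_integral_cong) (simp add: x act_add nabla_add ennreal_mult'[symmetric] ac_simps)
  then show ?thesis
    using x by (simp add: nn_integral_cmult S_sum_def)
qed

lemma S_act_eq_top_iff:
  assumes x: "x \<in> space \<mu>"
  shows "S f (act g x) = top \<longleftrightarrow> S f x = top"
proof -
  obtain c where c: "0 < c" "c < \<infinity>"
      "\<And>F. F \<in> borel_measurable borel \<Longrightarrow> (\<integral>\<^sup>+h. F (h + g) \<partial>haar) = c * (\<integral>\<^sup>+h. F h \<partial>haar)"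
    using nn_integral_right_translate[of g] by blast
  have "ennreal (nabla g x) * S f (act g x) = c * S f x"
    using c(3)[OF orbit_measurable[OF x]] S_act[OF x, of g] by (simp add: S_sum_def)
  then show ?thesis
    using c(1,2) nabla_pos[OF x, of g]
    by (metis ennreal_eq_0_iff ennreal_mult_eq_top_iff ennreal_neq_top infinity_ennreal_def less_irrefl not_le)
qed

lemma C_set_sets [measurable]: "C_set haar \<mu> act nabla f \<in> sets \<mu>"
  unfolding C_set_def by measurable

end

text \<open>
  Stability under each group element suffices for invariance, as the identity element already
  recovers the whole set.
\<close>

lemma G_invariantI:
  assumes "A \<subseteq> space \<mu>" "\<And>g x. x \<in> A \<Longrightarrow> act g x \<in> A"
  shows "G_invariant act A"
  unfolding G_invariant_def
proof (intro equalityI subsetI)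
  fix x assume "x \<in> A"
  then show "x \<in> (\<Union>g. act g ` A)"
    using assms(1) by (intro UN_I[of 0] image_eqI[of _ _ x]) auto
qed (use assms(2) in auto)

lemma G_invariant_C_set: "f \<in> L1_plus \<mu> \<Longrightarrow> G_invariant act (C_set haar \<mu> act nabla f)"
  by (intro G_invariantI) (auto simp: C_set_def S_act_eq_top_iff)

lemma G_invariant_D_set: "f \<in> L1_plus \<mu> \<Longrightarrow> G_invariant act (D_set haar \<mu> act nabla f)"
  by (intro G_invariantI) (auto simp: C_set_def D_set_def S_act_eq_top_iff)

section \<open>Independence of the function\<close>

text \<open>
  If \<open>S f\<close> is finite at \<open>y\<close>, then dividing \<open>f'\<close> by \<open>S f\<close> normalises it along the orbit of \<open>y\<close>, and by
  duality the integral of the quotient over inverses of group elements is \<open>S f' y / S f y\<close>. The integral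
  of this ratio against \<open>f\<close>, over the points where \<open>S f\<close> is finite, is at most the integral of \<open>f'\<close>. So
  the ratio is finite almost everywhere there.
\<close>

lemma AE_S_finite:
  assumes f: "f \<in> L1_plus \<mu>" and f': "f' \<in> L1_plus \<mu>"
  shows "AE x in \<mu>. S f x < \<infinity> \<longrightarrow> S f' x < \<infinity>"
proof -
  interpret P: pair_sigma_finite haar \<mu> by (rule pair_sigma_finite_haar)
  note [measurable] = f_measurable[OF f] f_measurable[OF f'] S_measurable[OF f] S_measurable[OF f']
  define \<phi> where "\<phi> x = ennreal (f' x) / S f x" for x
  have [measurable]: "\<phi> \<in> borel_measurable \<mu>" unfolding \<phi>_def by measurable
  \<comment> \<open>Exchange the integrals, substitute \<open>y = act g x\<close> for fixed \<open>g\<close>, and exchange them back.\<close>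
  have "(\<integral>\<^sup>+y. ennreal (f y) * (\<integral>\<^sup>+g. \<phi> (act (- g) y) \<partial>haar) \<partial>\<mu>)
      = (\<integral>\<^sup>+y. (\<integral>\<^sup>+g. ennreal (f y) * \<phi> (act (- g) y) \<partial>haar) \<partial>\<mu>)"
    by (intro nn_integral_cong nn_integral_cmult[symmetric]) measurable
  also have "\<dots> = (\<integral>\<^sup>+g. (\<integral>\<^sup>+y. ennreal (f y) * \<phi> (act (- g) y) \<partial>\<mu>) \<partial>haar)"
    by (intro P.Fubini') measurable
  also have "\<dots> = (\<integral>\<^sup>+g. (\<integral>\<^sup>+x. ennreal (nabla g x) * (ennreal (f (act g x)) * \<phi> x) \<partial>\<mu>) \<partial>haar)"
  proof (rule nn_integral_cong)
    fix g
    have "(\<integral>\<^sup>+x. ennreal (nabla g x) * (ennreal (f (act g x)) * \<phi> x) \<partial>\<mu>)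
        = (\<integral>\<^sup>+x. ennreal (f (act g (act (- g) x))) * \<phi> (act (- g) x) \<partial>\<mu>)"
      by (intro nn_integral_nabla) measurable
    then show "(\<integral>\<^sup>+y. ennreal (f y) * \<phi> (act (- g) y) \<partial>\<mu>)
        = (\<integral>\<^sup>+x. ennreal (nabla g x) * (ennreal (f (act g x)) * \<phi> x) \<partial>\<mu>)"
      by (simp add: act_act_uminus cong: nn_integral_cong_simp)
  qed
  also have "\<dots> = (\<integral>\<^sup>+x. (\<integral>\<^sup>+g. ennreal (nabla g x) * (ennreal (f (act g x)) * \<phi> x) \<partial>haar) \<partial>\<mu>)"
    by (intro P.Fubini'[symmetric]) measurable
  also have "\<dots> = (\<integral>\<^sup>+x. S f x * \<phi> x \<partial>\<mu>)"
  proof (rule nn_integral_cong)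
    fix x assume x: "x \<in> space \<mu>"
    have "(\<integral>\<^sup>+g. ennreal (nabla g x) * (ennreal (f (act g x)) * \<phi> x) \<partial>haar)
        = (\<integral>\<^sup>+g. ennreal (nabla g x * f (act g x)) * \<phi> x \<partial>haar)"
      using nabla_pos[OF x] x f_pos[OF f] by (intro nn_integral_cong) (simp add: ennreal_mult less_imp_le mult.assoc)
    also have "\<dots> = S f x * \<phi> x"
      unfolding S_sum_def by (intro nn_integral_multc) (use x in measurable)
    finally show "(\<integral>\<^sup>+g. ennreal (nabla g x) * (ennreal (f (act g x)) * \<phi> x) \<partial>haar) = S f x * \<phi> x" .
  qed
  also have "\<dots> \<le> (\<integral>\<^sup>+x. ennreal (f' x) \<partial>\<mu>)"
  proof (rule nn_integral_mono)
    fix x assume x: "x \<in> space \<mu>"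
    show "S f x * \<phi> x \<le> ennreal (f' x)"
    proof (cases "S f x = \<infinity>")
      case False
      then show ?thesis
        using S_pos[OF f x] by (simp add: \<phi>_def ennreal_times_divide ennreal_mult_divide_eq mult.commute)
    qed (simp add: \<phi>_def)
  qed
  also have "\<dots> = (\<integral>\<^sup>+x. ennreal (norm (f' x)) \<partial>\<mu>)"
    by (intro nn_integral_cong) (simp add: f_pos[OF f'] less_imp_le)
  also have "\<dots> < \<infinity>"
    using f' unfolding L1_plus_def integrable_iff_bounded by blast
  finally have "AE y in \<mu>. ennreal (f y) * (\<integral>\<^sup>+g. \<phi> (act (- g) y) \<partial>haar) \<noteq> \<infinity>"
    by (intro nn_integral_PInf_AE) auto
  then show ?thesis
  proof (rule AE_mp, intro AE_I2 impI)
    fix y assume y: "y \<in> space \<mu>" and fin: "ennreal (f y) * (\<integral>\<^sup>+g. \<phi> (act (- g) y) \<partial>haar) \<noteq> \<infinity>"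
      and Sfin: "S f y < \<infinity>"
    \<comment> \<open>Duality applies to \<open>\<phi>\<close> and \<open>f\<close> along the orbit of \<open>y\<close>; the denominator of \<open>\<phi>\<close> then cancels
        because \<open>S f\<close> is finite and nonzero on the whole orbit.\<close>
    have "(\<integral>\<^sup>+g. \<phi> (act (- g) y) \<partial>haar) * S f y
        = (\<integral>\<^sup>+g. \<phi> (act g y) * (\<integral>\<^sup>+h. ennreal (nabla (h + g) y * f (act (h + g) y)) \<partial>haar) \<partial>haar)"
      unfolding S_sum_def
      by (intro nn_integral_inversion_duality) (use y in measurable)
    also have "\<dots> = (\<integral>\<^sup>+g. \<phi> (act g y) * (ennreal (nabla g y) * S f (act g y)) \<partial>haar)"
      by (simp add: S_act[OF f y])
    also have "\<dots> = (\<integral>\<^sup>+g. ennreal (nabla g y * f' (act g y)) \<partial>haar)"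
    proof (rule nn_integral_cong)
      fix g
      have "S f (act g y) \<noteq> \<infinity>" "S f (act g y) \<noteq> 0"
        using S_act_eq_top_iff[OF f y] Sfin S_pos[OF f, of "act g y"] y by auto
      then have "\<phi> (act g y) * S f (act g y) = ennreal (f' (act g y))"
        unfolding \<phi>_def by (simp add: ennreal_divide_times less_top)
      then show "\<phi> (act g y) * (ennreal (nabla g y) * S f (act g y)) = ennreal (nabla g y * f' (act g y))"
        using nabla_pos[OF y, of g]
        by (simp add: ennreal_mult' mult.left_commute mult.commute)
    qed
    also have "\<dots> = S f' y" by (simp add: S_sum_def)
    finally have "S f' y = (\<integral>\<^sup>+g. \<phi> (act (- g) y) \<partial>haar) * S f y" ..
    moreover have "(\<integral>\<^sup>+g. \<phi> (act (- g) y) \<partial>haar) \<noteq> \<infinity>"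
      using fin f_pos[OF f y] by (auto simp: ennreal_mult_eq_top_iff)
    ultimately show "S f' y < \<infinity>"
      using Sfin by (simp add: less_top ennreal_mult_less_top)
  qed
qed


lemma sym_diff_C_set_null:
  assumes f: "f \<in> L1_plus \<mu>" and f': "f' \<in> L1_plus \<mu>"
  shows "sym_diff (C_set haar \<mu> act nabla f) (C_set haar \<mu> act nabla f') \<in> null_sets \<mu>"
proof -
  note [measurable] = S_measurable[OF f] S_measurable[OF f']
  have "AE x in \<mu>. S f x = \<infinity> \<longleftrightarrow> S f' x = \<infinity>"
    using AE_S_finite[OF f f'] AE_S_finite[OF f' f] by eventually_elim (auto simp: less_top[symmetric])
  then have "{x \<in> space \<mu>. \<not> (S f x = \<infinity> \<longleftrightarrow> S f' x = \<infinity>)} \<in> null_sets \<mu>"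
    by (subst AE_iff_null[symmetric]) measurable
  also have "{x \<in> space \<mu>. \<not> (S f x = \<infinity> \<longleftrightarrow> S f' x = \<infinity>)}
      = sym_diff (C_set haar \<mu> act nabla f) (C_set haar \<mu> act nabla f')"
    by (auto simp: C_set_def)
  finally show ?thesis .
qed

end

section \<open>Passage to an equivalent measure\<close>

lemma null_sets_equivalent_measures:
  "equivalent_measures M N \<Longrightarrow> null_sets M = null_sets N"
  by (auto simp: equivalent_measures_def absolutely_continuous_def)

lemma nonsingular_G_space_equivalent:
  fixes act :: "'g::topological_group_add \<Rightarrow> 'x \<Rightarrow> 'x"
  assumes M: "nonsingular_G_space M act" and N: "sigma_finite_measure N" "equivalent_measures N M"
  shows "nonsingular_G_space N act"
proof -
  have sets: "sets N = sets M" using N(2) by (simp add: equivalent_measures_def)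
  have space: "space N = space M" using sets by (rule sets_eq_imp_space_eq)
  have GM: "borel_G_space M act" using M by (simp add: nonsingular_G_space_def)
  have "measurable ((borel :: 'g measure) \<Otimes>\<^sub>M N) N = measurable (borel \<Otimes>\<^sub>M M) M"
    by (intro measurable_cong_sets sets_pair_measure_cong sets refl)
  then have GN: "borel_G_space N act"
    using GM by (simp add: borel_G_space_def standard_borel_space_def sets space)
  have sets_tr: "sets (translated_measure L act g) = sets L" for L g
    by (simp add: translated_measure_def)
  have tr_null: "A \<in> null_sets (translated_measure L act g) \<longleftrightarrow> A \<in> sets L \<and> emeasure L (act g ` A) = 0"
    if "borel_G_space L act" for L g A
    using that by (auto simp: null_sets_def sets_tr emeasure_translated_measure)
  interpret borel_G_action M act using GM by unfold_locales
  have act_image: "act g ` A \<in> sets M" if [measurable]: "A \<in> sets M" for A g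
    unfolding act_image[OF that] by measurable
  have "null_sets (translated_measure N act g) = null_sets (translated_measure M act g)" for g
  proof -
    have "emeasure N B = 0 \<longleftrightarrow> emeasure M B = 0" if "B \<in> sets M" for B
      using null_sets_equivalent_measures[OF N(2)] that sets by (auto simp: null_sets_def)
    then show ?thesis
      by (auto simp: tr_null[OF GM] tr_null[OF GN] sets act_image)
  qed
  then show ?thesis
    using M N GN null_sets_equivalent_measures[OF N(2)]
    by (simp add: nonsingular_G_space_def equivalent_measures_def absolutely_continuous_def sets_tr)
qed

text \<open>
  The derivative is finite almost everywhere because the new measure is sigma-finite, and nonzero
  almost everywhere because the set of its zeros is null for the new, hence for the old measure. On
  the remaining null set the value \<open>1\<close> is as good as any positive real.
\<close>

lemma (in sigma_finite_measure) obtain_positive_density: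
  assumes N: "sigma_finite_measure N" "equivalent_measures N M"
  obtains d :: "'a \<Rightarrow> real"
    where "d \<in> borel_measurable M" "\<And>x. 0 < d x" "density M (\<lambda>x. ennreal (d x)) = N"
proof -
  have ac: "absolutely_continuous M N" and sets: "sets N = sets M"
    using N(2) by (auto simp: equivalent_measures_def)
  define D where "D = RN_deriv M N"
  have [measurable]: "D \<in> borel_measurable M" by (simp add: D_def)
  have D: "density M D = N"
    unfolding D_def by (intro density_RN_deriv ac sets)
  have fin: "AE x in M. D x \<noteq> \<infinity>"
    unfolding D_def by (intro RN_deriv_finite N(1) ac sets)
  have "{x \<in> space M. D x = 0} \<in> null_sets N"
    unfolding D[symmetric] by (subst null_sets_density_iff) auto
  then have "{x \<in> space M. D x = 0} \<in> null_sets M"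
    using null_sets_equivalent_measures[OF N(2)] by simp
  then have pos: "AE x in M. D x \<noteq> 0"
    by (intro AE_I'[of "{x \<in> space M. D x = 0}"]) auto
  define d where "d x = (if D x = 0 \<or> D x = \<infinity> then 1 else enn2real (D x))" for x
  have [measurable]: "d \<in> borel_measurable M" unfolding d_def by measurable
  have "AE x in M. ennreal (d x) = D x"
    using fin pos by eventually_elim (simp add: d_def less_top)
  then have "density M (\<lambda>x. ennreal (d x)) = N"
    unfolding D[symmetric] by (intro density_cong) measurable
  moreover have "0 < d x" for x
    by (auto simp: d_def enn2real_positive_iff less_top zero_less_iff_neq_zero)
  ultimately show thesis by (intro that[of d]) auto
qed

context nonsingular_action
begin

text \<open>
  Multiplied by \<open>d x\<close> and \<open>nabla g x\<close> respectively, \<open>nabla' g x\<close> and \<open>d (act g x)\<close> are both densities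
  with respect to \<open>\<mu>\<close> of the translate of \<open>N\<close> by \<open>g\<close>. Densities are unique almost everywhere.
\<close>

lemma cocycle_of_equivalent_measure:
  assumes N: "nonsingular_action haar N act nabla'"
    and [measurable]: "d \<in> borel_measurable \<mu>" and d_pos: "\<And>x. 0 < d x"
    and d: "density \<mu> (\<lambda>x. ennreal (d x)) = N"
  shows "AE x in \<mu>. nabla' g x * d x = nabla g x * d (act g x)"
proof -
  interpret N: nonsingular_action haar N act nabla' by fact
  have sets [measurable_cong]: "sets N = sets \<mu>" unfolding d[symmetric] by simp
  note space = sets_eq_imp_space_eq[OF sets]
  have "density \<mu> (\<lambda>x. ennreal (nabla g x) * ennreal (d (act g x)))
      = density \<mu> (\<lambda>x. ennreal (d x) * ennreal (nabla' g x))"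
  proof (rule measure_eqI)
    fix A assume "A \<in> sets (density \<mu> (\<lambda>x. ennreal (nabla g x) * ennreal (d (act g x))))"
    then have [measurable]: "A \<in> sets \<mu>" by simp
    have "emeasure (density \<mu> (\<lambda>x. ennreal (nabla g x) * ennreal (d (act g x)))) A
        = (\<integral>\<^sup>+x. ennreal (nabla g x) * (ennreal (d (act g x)) * indicator A x) \<partial>\<mu>)"
      by (subst emeasure_density) (auto simp: mult.assoc)
    also have "\<dots> = (\<integral>\<^sup>+x. ennreal (d (act g (act (- g) x))) * indicator A (act (- g) x) \<partial>\<mu>)"
      by (intro nn_integral_nabla) measurable
    also have "\<dots> = (\<integral>\<^sup>+x. ennreal (d x) * indicator (act (- g) -` A \<inter> space \<mu>) x \<partial>\<mu>)"
      by (intro nn_integral_cong) (auto simp: act_act_uminus indicator_def)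
    also have "\<dots> = emeasure N (act (- g) -` A \<inter> space N)"
      unfolding d[symmetric] by (subst emeasure_density) auto
    also have "\<dots> = emeasure (density N (\<lambda>x. ennreal (nabla' g x))) A"
      unfolding N.density_nabla by (subst emeasure_distr) auto
    also have "density N (\<lambda>x. ennreal (nabla' g x)) = density \<mu> (\<lambda>x. ennreal (d x) * ennreal (nabla' g x))"
      unfolding d[symmetric] by (intro density_density_eq) measurable
    finally show "emeasure (density \<mu> (\<lambda>x. ennreal (nabla g x) * ennreal (d (act g x)))) A
        = emeasure (density \<mu> (\<lambda>x. ennreal (d x) * ennreal (nabla' g x))) A" .
  qed simp
  then have "AE x in \<mu>. ennreal (nabla g x) * ennreal (d (act g x)) = ennreal (d x) * ennreal (nabla' g x)"
    by (subst (asm) X.density_unique_iff) measurable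
  moreover have "AE x in \<mu>. x \<in> space \<mu>" by simp
  ultimately show ?thesis
  proof eventually_elim
    case (elim x)
    then have "0 < nabla g x" "0 < nabla' g x" by (auto simp: nabla_pos N.nabla_pos space)
    with elim(1) d_pos[of x] d_pos[of "act g x"] show ?case
      by (simp add: ennreal_mult[symmetric] less_imp_le mult.commute)
  qed
qed

text \<open>
  The functions are matched by \<open>f = d * f'\<close>, for which \<open>S f\<close> is almost everywhere \<open>d\<close> times the
  corresponding integral of \<open>f'\<close>. The relation between the cocycles has a null set of exceptional
  points that depends on the group element; by Tonelli, almost every point has it at almost every
  group element, which is what the integral over the group sees.
\<close>

lemma sym_diff_C_set_equivalent_null:
  assumes N: "nonsingular_action haar N act nabla'" and eq: "equivalent_measures N \<mu>"
  obtains f f' where "f \<in> L1_plus \<mu>" "f' \<in> L1_plus N"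
    "sym_diff (C_set haar \<mu> act nabla f) (C_set haar N act nabla' f') \<in> null_sets \<mu>"
proof -
  interpret N: nonsingular_action haar N act nabla' by fact
  interpret P: pair_sigma_finite haar \<mu> by (rule pair_sigma_finite_haar)
  obtain d where [measurable]: "d \<in> borel_measurable \<mu>" and d_pos: "\<And>x. 0 < d x"
    and d: "density \<mu> (\<lambda>x. ennreal (d x)) = N"
    using X.obtain_positive_density[OF N.X.sigma_finite_measure_axioms eq] by blast
  have sets [measurable_cong]: "sets N = sets \<mu>" using eq by (simp add: equivalent_measures_def)
  note space = sets_eq_imp_space_eq[OF sets]
  obtain f' where f': "f' \<in> L1_plus N"
    using L1_plus_nonempty[OF N.X.sigma_finite_measure_axioms] by blast
  note f'_meas = N.f_measurable[OF f']
  have [measurable]: "f' \<in> borel_measurable \<mu>"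
    using f'_meas by measurable
  define f where "f x = d x * f' x" for x
  have "integrable (density \<mu> (\<lambda>x. ennreal (d x))) f'"
    using f' by (simp add: L1_plus_def d)
  then have "integrable \<mu> f"
    by (subst (asm) integrable_density) (auto simp: f_def[abs_def] less_imp_le d_pos)
  then have f: "f \<in> L1_plus \<mu>"
    using N.f_pos[OF f'] d_pos by (simp add: L1_plus_def f_def space)
  note [measurable] = S_measurable[OF f] N.S_measurable[OF f']
  have "AE x in \<mu>. nabla' g x * d x = nabla g x * d (act g x)" for g
    by (rule cocycle_of_equivalent_measure[OF N _ d_pos d]) measurable
  then have "AE g in haar. AE x in \<mu>. nabla' g x * d x = nabla g x * d (act g x)" by simp
  then have "AE x in \<mu>. AE g in haar. nabla' g x * d x = nabla g x * d (act g x)"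
    by (subst (asm) P.AE_commute) measurable
  then have "AE x in \<mu>. S f x = \<infinity> \<longleftrightarrow> N.S f' x = \<infinity>"
  proof (rule AE_mp, intro AE_I2 impI)
    fix x assume x: "x \<in> space \<mu>" and rel: "AE g in haar. nabla' g x * d x = nabla g x * d (act g x)"
    have "S f x = (\<integral>\<^sup>+g. ennreal (d x) * ennreal (nabla' g x * f' (act g x)) \<partial>haar)"
      unfolding S_sum_def
    proof (rule nn_integral_cong_AE, use rel in eventually_elim)
      case (elim g)
      then have "nabla g x * f (act g x) = d x * (nabla' g x * f' (act g x))"
        by (simp add: f_def mult.assoc[symmetric]) (simp add: mult.commute)
      then show ?case using d_pos[of x] by (simp add: ennreal_mult' less_imp_le)
    qed
    also have "\<dots> = ennreal (d x) * N.S f' x"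
      unfolding S_sum_def using N.orbit_measurable[OF f', of x] x
      by (intro nn_integral_cmult) (simp add: space measurable_cong_sets[OF sets_haar refl])
    finally show "S f x = \<infinity> \<longleftrightarrow> N.S f' x = \<infinity>"
      using d_pos[of x] by (simp add: ennreal_mult_eq_top_iff)
  qed
  then have "{x \<in> space \<mu>. \<not> (S f x = \<infinity> \<longleftrightarrow> N.S f' x = \<infinity>)} \<in> null_sets \<mu>"
    by (subst AE_iff_null[symmetric]) measurable
  also have "{x \<in> space \<mu>. \<not> (S f x = \<infinity> \<longleftrightarrow> N.S f' x = \<infinity>)}
      = sym_diff (C_set haar \<mu> act nabla f) (C_set haar N act nabla' f')"
    by (auto simp: C_set_def space)
  finally show thesis by (intro that[of f f'] f f')
qed

end

section \<open>Existence and uniqueness of the decomposition\<close>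

lemma sym_diff_null_sets_trans:
  assumes "sym_diff A B \<in> null_sets M" "sym_diff B C \<in> null_sets M" "A \<in> sets M" "C \<in> sets M"
  shows "sym_diff A C \<in> null_sets M"
proof (rule null_sets_subset)
  show "sym_diff A B \<union> sym_diff B C \<in> null_sets M" using assms by auto
qed (use assms in auto)

lemma sym_diff_complement:
  "A \<subseteq> X \<Longrightarrow> B \<subseteq> X \<Longrightarrow> sym_diff (X - A) (X - B) = sym_diff A B"
  by auto

lemma hopf_decomposition_complement:
  "hopf_decomposition haar M act nabla C D \<Longrightarrow> D = space M - C"
  by (auto simp: hopf_decomposition_def)

context nonsingular_action
begin

lemma hopf_decomposition_C_D_set:
  assumes f: "f \<in> L1_plus \<mu>"
  shows "hopf_decomposition haar \<mu> act nabla (C_set haar \<mu> act nabla f) (D_set haar \<mu> act nabla f)"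
  unfolding hopf_decomposition_def
proof (intro conjI ballI)
  let ?C = "C_set haar \<mu> act nabla"
  have sub: "?C f' \<subseteq> space \<mu>" for f' by (auto simp: C_set_def)
  show "?C f \<union> D_set haar \<mu> act nabla f = space \<mu>" using sub by (auto simp: D_set_def)
  fix f' assume f': "f' \<in> L1_plus \<mu>"
  show "sym_diff (?C f) (?C f') \<in> null_sets \<mu>"
    by (rule sym_diff_C_set_null[OF f f'])
  then show "sym_diff (D_set haar \<mu> act nabla f) (D_set haar \<mu> act nabla f') \<in> null_sets \<mu>"
    by (simp add: D_set_def sym_diff_complement sub)
qed (auto simp: D_set_def C_set_sets f G_invariant_C_set G_invariant_D_set[unfolded D_set_def])

text \<open>
  Stated for two equivalent measures, this covers the uniqueness for a single measure as well.
\<close>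

lemma hopf_decomposition_unique:
  assumes N: "nonsingular_action haar N act nabla'" and eq: "equivalent_measures N \<mu>"
    and CD: "hopf_decomposition haar \<mu> act nabla C D"
    and CD': "hopf_decomposition haar N act nabla' C' D'"
  shows "sym_diff C C' \<in> null_sets \<mu> \<and> sym_diff D D' \<in> null_sets \<mu>"
proof -
  interpret N: nonsingular_action haar N act nabla' by fact
  note null = null_sets_equivalent_measures[OF eq]
  have sets: "sets N = sets \<mu>" using eq by (simp add: equivalent_measures_def)
  note space = sets_eq_imp_space_eq[OF sets]
  obtain f f' where f: "f \<in> L1_plus \<mu>" and f': "f' \<in> L1_plus N"
    and ff': "sym_diff (C_set haar \<mu> act nabla f) (C_set haar N act nabla' f') \<in> null_sets \<mu>"
    using sym_diff_C_set_equivalent_null[OF N eq] by blast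
  have C: "C \<in> sets \<mu>" "C' \<in> sets \<mu>"
    using CD CD' by (auto simp: hopf_decomposition_def sets)
  have 1: "sym_diff C (C_set haar \<mu> act nabla f) \<in> null_sets \<mu>"
    using CD f by (simp add: hopf_decomposition_def)
  have "sym_diff C' (C_set haar N act nabla' f') \<in> null_sets \<mu>"
    using CD' f' unfolding hopf_decomposition_def null by blast
  then have 2: "sym_diff (C_set haar N act nabla' f') C' \<in> null_sets \<mu>"
    by (simp add: Un_commute)
  have "C_set haar N act nabla' f' \<in> sets \<mu>"
    using N.C_set_sets[OF f'] sets by simp
  then have CC': "sym_diff C C' \<in> null_sets \<mu>"
    using sym_diff_null_sets_trans[OF sym_diff_null_sets_trans[OF 1 ff'] 2] C by blast
  moreover have "sym_diff D D' = sym_diff C C'"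
    using hopf_decomposition_complement[OF CD] hopf_decomposition_complement[OF CD']
      sets.sets_into_space[OF C(1)] sets.sets_into_space[OF C(2)]
    by (simp add: space sym_diff_complement)
  ultimately show ?thesis by simp
qed

end

theorem theoremA:
  fixes haar :: "'g::{topological_group_add, t2_space, second_countable_topology} measure"
    and \<mu> :: "'x measure"
    and act :: "'g \<Rightarrow> 'x \<Rightarrow> 'x"
    and nabla :: "'g \<Rightarrow> 'x \<Rightarrow> real"
  assumes "locally_compact_space (euclidean :: 'g topology)"
    and "left_haar_measure haar"
    and "nonsingular_G_space \<mu> act"
    and "radon_nikodym_cocycle \<mu> act nabla"
  shows "(\<exists>C D. hopf_decomposition haar \<mu> act nabla C D \<and>
            (\<forall>C' D'. hopf_decomposition haar \<mu> act nabla C' D' \<longrightarrow>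
               sym_diff C C' \<in> null_sets \<mu> \<and> sym_diff D D' \<in> null_sets \<mu>))
       \<and> (\<forall>f\<in>L1_plus \<mu>. \<forall>f'\<in>L1_plus \<mu>.
            sym_diff (C_set haar \<mu> act nabla f) (C_set haar \<mu> act nabla f') \<in> null_sets \<mu> \<and>
            sym_diff (D_set haar \<mu> act nabla f) (D_set haar \<mu> act nabla f') \<in> null_sets \<mu>)
       \<and> (\<forall>\<mu>' nabla'. sigma_finite_measure \<mu>' \<and> equivalent_measures \<mu>' \<mu> \<and>
            radon_nikodym_cocycle \<mu>' act nabla' \<longrightarrow>
            (\<forall>C D C' D'. hopf_decomposition haar \<mu> act nabla C D \<and>
               hopf_decomposition haar \<mu>' act nabla' C' D' \<longrightarrow>
               sym_diff C C' \<in> null_sets \<mu> \<and> sym_diff D D' \<in> null_sets \<mu>))"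
proof -
  interpret nonsingular_action haar \<mu> act nabla
    using assms by unfold_locales
  have self: "nonsingular_action haar \<mu> act nabla" "equivalent_measures \<mu> \<mu>"
    by (rule nonsingular_action_axioms) (simp add: equivalent_measures_def absolutely_continuous_def)
  obtain f where f: "f \<in> L1_plus \<mu>"
    using L1_plus_nonempty[OF X.sigma_finite_measure_axioms] by blast
  show ?thesis
  proof (intro conjI)
    show "\<exists>C D. hopf_decomposition haar \<mu> act nabla C D \<and>
            (\<forall>C' D'. hopf_decomposition haar \<mu> act nabla C' D' \<longrightarrow>
               sym_diff C C' \<in> null_sets \<mu> \<and> sym_diff D D' \<in> null_sets \<mu>)"
      using hopf_decomposition_C_D_set[OF f] hopf_decomposition_unique[OF self] by blast
    show "\<forall>f\<in>L1_plus \<mu>. \<forall>f'\<in>L1_plus \<mu>.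
            sym_diff (C_set haar \<mu> act nabla f) (C_set haar \<mu> act nabla f') \<in> null_sets \<mu> \<and>
            sym_diff (D_set haar \<mu> act nabla f) (D_set haar \<mu> act nabla f') \<in> null_sets \<mu>"
      using hopf_decomposition_C_D_set unfolding hopf_decomposition_def by blast
    show "\<forall>\<mu>' nabla'. sigma_finite_measure \<mu>' \<and> equivalent_measures \<mu>' \<mu> \<and>
            radon_nikodym_cocycle \<mu>' act nabla' \<longrightarrow>
            (\<forall>C D C' D'. hopf_decomposition haar \<mu> act nabla C D \<and>
               hopf_decomposition haar \<mu>' act nabla' C' D' \<longrightarrow>
               sym_diff C C' \<in> null_sets \<mu> \<and> sym_diff D D' \<in> null_sets \<mu>)"
    proof (intro allI impI, elim conjE)
      fix \<mu>' nabla' C D C' D'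
      assume N: "sigma_finite_measure \<mu>'" "equivalent_measures \<mu>' \<mu>"
          "radon_nikodym_cocycle \<mu>' act nabla'"
        and dec: "hopf_decomposition haar \<mu> act nabla C D"
          "hopf_decomposition haar \<mu>' act nabla' C' D'"
      have "nonsingular_action haar \<mu>' act nabla'"
        using nonsingular_G_space_equivalent[OF assms(3) N(1,2)] N(3)
        by unfold_locales
      then show "sym_diff C C' \<in> null_sets \<mu> \<and> sym_diff D D' \<in> null_sets \<mu>"
        using N(2) dec by (rule hopf_decomposition_unique)
    qed
  qed
qed

end
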